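(* For each integer $i\ge 1$, let $\lambda_i$ and $\widetilde\lambda_i$ be the smallest houses larger than $1$ among all monic integer reciprocal polynomials of degree $2^i$ and among all monic integer skew-reciprocal polynomials of degree $2^i$, respectively. Let $r_i=2^i\log(\lambda_i)$, $s_i=2^i\log(\widetilde\lambda_i)$, and $q_m=\prod_{i=1}^m \frac{r_i}{s_i}$ for $m\ge1$. Then the following are equivalent: (a) there exists a universal constant $c>0$ such that every house larger than $1$ of an irreducible monic integer polynomial of degree $d$ is at least $1+\frac{c}{d}$; (b) the set $\left\{\frac{q_N}{q_n} : n,N\in\mathbf{N},\ n<N\right\}\subset\mathbf{R}$ is bounded away from zero.
   Context: For a monic polynomial $f\in\mathbf{Z}[t]$, its house is $\max_{f(\alpha)=0}|\alpha|$, the largest modulus of its complex zeroes. A polynomial $f\in\mathbf{Z}[t]$ of degree $d$ is reciprocal if $f(t)=t^d f(t^{-1})$. A polynomial $f\in\mathbf{Z}[t]$ of even degree $2d$ is skew-reciprocal if $f(t)=(-1)^d t^{2d} f(-t^{-1})$. *)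

theory Defs
  imports Complex_Main "HOL-Computational_Algebra.Computational_Algebra"
begin

definition house :: "int poly \<Rightarrow> real" where
  "house f = Max (cmod ` {z. poly (map_poly of_int f) z = 0})"

definition reciprocal :: "int poly \<Rightarrow> bool" where
  "reciprocal f \<longleftrightarrow> f = reflect_poly f"

text \<open>The polynomial \<open>reflect_poly (f \<circ>\<^sub>p [:0, -1:])\<close> is \<open>t\<^sup>n f(-1/t)\<close> with \<open>n = degree f\<close>; see
  \<open>skew_reciprocal_iff_poly\<close> below.\<close>

definition skew_reciprocal :: "int poly \<Rightarrow> bool" where
  "skew_reciprocal f \<longleftrightarrow> even (degree f) \<and>
     f = smult ((-1) ^ (degree f div 2)) (reflect_poly (f \<circ>\<^sub>p [:0, -1:]))"

definition lambda_rec :: "nat \<Rightarrow> real" where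
  "lambda_rec i = (LEAST x. x > 1 \<and>
     (\<exists>f. lead_coeff f = 1 \<and> degree f = 2 ^ i \<and> reciprocal f \<and> x = house f))"

definition lambda_skew :: "nat \<Rightarrow> real" where
  "lambda_skew i = (LEAST x. x > 1 \<and>
     (\<exists>f. lead_coeff f = 1 \<and> degree f = 2 ^ i \<and> skew_reciprocal f \<and> x = house f))"

definition r_seq :: "nat \<Rightarrow> real" where
  "r_seq i = 2 ^ i * ln (lambda_rec i)"

definition s_seq :: "nat \<Rightarrow> real" where
  "s_seq i = 2 ^ i * ln (lambda_skew i)"

definition q_seq :: "nat \<Rightarrow> real" where
  "q_seq m = (\<Prod>i=1..m. r_seq i / s_seq i)"

definition bounded_away_from_zero :: "real set \<Rightarrow> bool" where
  "bounded_away_from_zero S \<longleftrightarrow> (\<exists>\<epsilon>>0. \<forall>x\<in>S. \<epsilon> \<le> \<bar>x\<bar>)"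


lemma poly_of_int_eqI:
  fixes f g :: "int poly"
  assumes "\<And>t::real. t \<noteq> 0 \<Longrightarrow> poly (map_poly of_int f) t = poly (map_poly of_int g) t"
  shows "f = g"
proof -
  let ?h = "map_poly of_int f - map_poly of_int g :: real poly"
  have "infinite (UNIV - {0::real})"
    by (simp add: infinite_UNIV_char_0)
  moreover have "UNIV - {0} \<subseteq> {t. poly ?h t = 0}"
    using assms by auto
  ultimately have "infinite {t. poly ?h t = 0}"
    using finite_subset by blast
  then have "?h = 0"
    using poly_roots_finite by blast
  then have eq: "map_poly of_int f = (map_poly of_int g :: real poly)"
    by simp
  have "of_int (coeff f n) = (of_int (coeff g n) :: real)" for n
    using arg_cong[OF eq, of "\<lambda>p. coeff p n"] by (simp add: coeff_map_poly)
  then show ?thesis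
    by (intro poly_eqI) simp
qed

lemma map_poly_of_int_reflect:
  "map_poly of_int (reflect_poly f) = (reflect_poly (map_poly of_int f) :: real poly)"
  by (intro poly_eqI) (simp add: coeff_map_poly coeff_reflect_poly degree_map_poly)

lemma poly_of_int_reflect:
  fixes t :: real
  assumes "t \<noteq> 0"
  shows "poly (map_poly of_int (reflect_poly f)) t = t ^ degree f * poly (map_poly of_int f) (1 / t)"
  using assms by (simp add: map_poly_of_int_reflect poly_reflect_poly_nz degree_map_poly divide_inverse)

lemma map_poly_of_int_pcompose_neg:
  "map_poly of_int (f \<circ>\<^sub>p [:0, -1:]) = (map_poly of_int f \<circ>\<^sub>p [:0, -1:] :: real poly)"
proof (induction f)
  case (pCons a p)
  have add: "map_poly of_int (u + v) = (map_poly of_int u + map_poly of_int v :: real poly)" for u v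
    by (intro poly_eqI) (simp add: coeff_map_poly)
  have minus: "map_poly of_int (- u) = (- map_poly of_int u :: real poly)" for u
    by (intro poly_eqI) (simp add: coeff_map_poly)
  show ?case
    using pCons by (simp add: pcompose_pCons map_poly_pCons add minus)
qed simp

lemma reciprocal_iff_poly:
  "reciprocal f \<longleftrightarrow> (\<forall>t::real. t \<noteq> 0 \<longrightarrow>
     poly (map_poly of_int f) t = t ^ degree f * poly (map_poly of_int f) (1 / t))"
  unfolding reciprocal_def
  using poly_of_int_reflect[of _ f] poly_of_int_eqI[of f "reflect_poly f"] by metis

lemma skew_reciprocal_iff_poly:
  "skew_reciprocal f \<longleftrightarrow> even (degree f) \<and> (\<forall>t::real. t \<noteq> 0 \<longrightarrow>
     poly (map_poly of_int f) t
       = (-1) ^ (degree f div 2) * t ^ degree f * poly (map_poly of_int f) (- 1 / t))"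
proof -
  let ?g = "smult ((-1) ^ (degree f div 2)) (reflect_poly (f \<circ>\<^sub>p [:0, -1:]))"
  have sm: "map_poly of_int (smult c u) = (smult (of_int c) (map_poly of_int u) :: real poly)" for c u
    by (intro poly_eqI) (simp add: coeff_map_poly)
  have "poly (map_poly of_int ?g) t
       = (-1) ^ (degree f div 2) * t ^ degree f * poly (map_poly of_int f) (- 1 / t)"
    if "t \<noteq> 0" for t :: real
    using that
    by (simp add: sm poly_of_int_reflect degree_pcompose map_poly_of_int_pcompose_neg poly_pcompose)
  then show ?thesis
    unfolding skew_reciprocal_def using poly_of_int_eqI[of f ?g] by metis
qed

end

theory Submission
  imports Defs "HOL-Complex_Analysis.Conformal_Mappings"
begin

text \<open>
  If \<open>f\<close> is reciprocal of even degree, then \<open>f(t\<^sup>2)\<close> is both reciprocal and skew-reciprocal, so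
  \<open>r\<^sub>i\<^sub>+\<^sub>1 \<le> r\<^sub>i\<close> and \<open>s\<^sub>i\<^sub>+\<^sub>1 \<le> r\<^sub>i\<close>. Telescoping gives \<open>q\<^sub>N / q\<^sub>n \<ge> r\<^sub>N / s\<^sub>n\<^sub>+\<^sub>1\<close>, and (a) bounds \<open>r\<^sub>N\<close> from
  below.

  Conversely, let \<open>p\<close> be an irreducible factor of largest house of an extremal skew-reciprocal \<open>f\<close> of
  degree \<open>2\<^sup>i\<^sup>+\<^sup>1\<close>. If \<open>p\<close> is not reciprocal, the product of its zeroes outside the unit circle is at
  least \<open>\<surd>5/2\<close> in modulus, a weak form of Smyth's theorem, so \<open>s\<^sub>i\<^sub>+\<^sub>1\<close> is not small. If \<open>p\<close> is
  reciprocal, then \<open>p(-t)\<close> divides \<open>f\<close> as well; either \<open>p(t) p(-t)\<close> divides \<open>f\<close>, or \<open>p(t) = u(t\<^sup>2)\<close>,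
  and in both cases \<open>r\<^sub>i \<le> s\<^sub>i\<^sub>+\<^sub>1\<close>. Hence if \<open>r\<^sub>i\<close> tends to 0, then eventually \<open>r\<^sub>i = s\<^sub>i\<^sub>+\<^sub>1\<close>, and
  \<open>q\<^sub>N / q\<^sub>n = r\<^sub>N / s\<^sub>n\<^sub>+\<^sub>1\<close> tends to 0 as \<open>N\<close> grows, contradicting (b). So (b) bounds \<open>r\<^sub>i\<close> from
  below, which is (a) for reciprocal polynomials after padding the degree to a power of two with
  factors \<open>t + 1\<close>.
\<close>

subsection \<open>Houses of integer polynomials\<close>

abbreviation cpoly :: "int poly \<Rightarrow> complex poly" where
  "cpoly f \<equiv> map_poly of_int f"

lemma cpoly_add: "cpoly (f + g) = cpoly f + cpoly g"
  by (intro poly_eqI) (simp add: coeff_map_poly)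

lemma cpoly_diff: "cpoly (f - g) = cpoly f - cpoly g"
  by (intro poly_eqI) (simp add: coeff_map_poly)

lemma cpoly_minus: "cpoly (- f) = - cpoly f"
  by (intro poly_eqI) (simp add: coeff_map_poly)

lemma cpoly_smult: "cpoly (smult c f) = smult (of_int c) (cpoly f)"
  by (intro poly_eqI) (simp add: coeff_map_poly)

lemma cpoly_mult: "cpoly (f * g) = cpoly f * cpoly g"
  by (intro poly_eqI) (simp add: coeff_map_poly coeff_mult)

lemma cpoly_monom: "cpoly (monom c n) = monom (of_int c) n"
  by (intro poly_eqI) (simp add: coeff_map_poly)

lemma cpoly_power: "cpoly (f ^ n) = cpoly f ^ n"
  by (induction n) (simp_all add: cpoly_mult map_poly_pCons one_pCons)

lemma cpoly_pcompose: "cpoly (f \<circ>\<^sub>p g) = cpoly f \<circ>\<^sub>p cpoly g"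
  by (induction f) (simp_all add: pcompose_pCons cpoly_add cpoly_mult map_poly_pCons)

lemma degree_cpoly: "degree (cpoly f) = degree f"
  by (simp add: degree_map_poly)

lemma cpoly_eq_0_iff: "cpoly f = 0 \<longleftrightarrow> f = 0"
  by (simp add: map_poly_eq_0_iff)

lemma cpoly_reflect: "cpoly (reflect_poly f) = reflect_poly (cpoly f)"
  by (intro poly_eqI) (simp add: coeff_map_poly coeff_reflect_poly degree_cpoly)

lemma poly_cpoly_0: "poly (cpoly f) 0 = of_int (coeff f 0)"
  by (simp add: poly_0_coeff_0 coeff_map_poly)

lemma poly_cpoly_cnj: "poly (cpoly f) (cnj z) = cnj (poly (cpoly f) z)"
  by (induction f) (simp_all add: map_poly_pCons)

lemma poly_cpoly_dvd: "f dvd g \<Longrightarrow> poly (cpoly f) z = 0 \<Longrightarrow> poly (cpoly g) z = 0"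
  by (auto simp: dvd_def cpoly_mult)

lemma finite_roots_cpoly: "f \<noteq> 0 \<Longrightarrow> finite {z. poly (cpoly f) z = 0}"
  by (simp add: poly_roots_finite cpoly_eq_0_iff)

lemma cpoly_root_exists: "degree f > 0 \<Longrightarrow> \<exists>z. poly (cpoly f) z = 0"
  using Fundamental_Theorem_Algebra.fundamental_theorem_of_algebra[of "cpoly f"]
  by (metis constant_degree degree_cpoly neq0_conv)

lemma degree_pos_of_root:
  assumes "f \<noteq> 0" "poly (cpoly f) z = 0"
  shows "0 < degree f"
proof (rule ccontr)
  assume "\<not> 0 < degree f"
  then obtain c where "f = [:c:]" by (auto elim: degree_eq_zeroE)
  then show False using assms by (simp add: map_poly_pCons)
qed

lemma norm_root_le_house:
  assumes "f \<noteq> 0" "poly (cpoly f) z = 0"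
  shows "cmod z \<le> house f"
  unfolding house_def using assms finite_roots_cpoly by (intro Max_ge) auto

lemma house_attained:
  assumes "degree f > 0"
  obtains z where "poly (cpoly f) z = 0" "cmod z = house f"
proof -
  have "house f \<in> cmod ` {z. poly (cpoly f) z = 0}"
    unfolding house_def using assms finite_roots_cpoly[of f] cpoly_root_exists[OF assms]
    by (intro Max_in) fastforce+
  then show ?thesis using that by auto
qed

lemma house_le:
  assumes "degree f > 0" "\<And>z. poly (cpoly f) z = 0 \<Longrightarrow> cmod z \<le> B"
  shows "house f \<le> B"
  using assms house_attained by metis

lemma house_nonneg: "degree f > 0 \<Longrightarrow> 0 \<le> house f"
  using house_attained norm_ge_zero by metis

lemma house_eq_of_dvd:
  assumes "f dvd g" "g \<noteq> 0" "poly (cpoly f) z = 0" "cmod z = house g"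
  shows "house f = house g"
proof -
  have f0: "f \<noteq> 0" using assms by auto
  have "degree f > 0" using f0 assms(3) by (rule degree_pos_of_root)
  then have "house f \<le> house g"
    using assms by (intro house_le norm_root_le_house) (auto intro: poly_cpoly_dvd)
  moreover have "house g \<le> house f" using norm_root_le_house[OF f0 assms(3)] assms(4) by simp
  ultimately show ?thesis by simp
qed

section \<open>Finiteness of bounded houses and existence of least ones\<close>

lemma cpoly_linear_factors:
  assumes "lead_coeff f = 1"
  obtains \<alpha> where "\<And>z. poly (cpoly f) z = (\<Prod>i<degree f. z - \<alpha> i)"
    and "cpoly f = (\<Prod>i<degree f. [:- \<alpha> i, 1:])"
    and "\<And>i. i < degree f \<Longrightarrow> poly (cpoly f) (\<alpha> i) = 0"
proof -
  obtain \<alpha> where "smult (lead_coeff (cpoly f)) (\<Prod>i<degree (cpoly f). [:- \<alpha> i, 1:]) = cpoly f"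
    by (rule complex_poly_decompose')
  moreover have "lead_coeff (cpoly f) = 1"
    using assms by (simp add: degree_cpoly coeff_map_poly)
  ultimately have eq: "cpoly f = (\<Prod>i<degree f. [:- \<alpha> i, 1:])" by (simp add: degree_cpoly)
  then have ev: "poly (cpoly f) z = (\<Prod>i<degree f. z - \<alpha> i)" for z
    by (simp add: poly_prod)
  show ?thesis using that[OF ev eq] ev by auto
qed

text \<open>Each new factor \<open>t - \<alpha>\<close> enlarges a common bound for all coefficients
  by at most the factor \<open>1 + B\<close>.\<close>

lemma norm_coeff_prod_linear_le:
  fixes \<alpha> :: "nat \<Rightarrow> complex"
  assumes "\<And>i. i < n \<Longrightarrow> cmod (\<alpha> i) \<le> B" "0 \<le> B"
  shows "cmod (coeff (\<Prod>i<n. [:- \<alpha> i, 1:]) k) \<le> (1 + B) ^ n"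
  using assms(1)
proof (induction n arbitrary: k)
  case 0
  then show ?case by (simp add: coeff_1)
next
  case (Suc n)
  let ?P = "\<Prod>i<n. [:- \<alpha> i, 1:]"
  have IH: "cmod (coeff ?P k) \<le> (1 + B) ^ n" for k using Suc by auto
  have "coeff (\<Prod>i<Suc n. [:- \<alpha> i, 1:]) k
      = - \<alpha> n * coeff ?P k + (case k of 0 \<Rightarrow> 0 | Suc j \<Rightarrow> coeff ?P j)"
    by (simp add: mult.commute[of _ "[:- \<alpha> n, 1:]"] coeff_pCons split: nat.split)
  also have "cmod \<dots> \<le> B * (1 + B) ^ n + (1 + B) ^ n"
  proof (rule norm_triangle_le[OF add_mono])
    show "cmod (- \<alpha> n * coeff ?P k) \<le> B * (1 + B) ^ n"
      unfolding norm_mult norm_minus_cancel using Suc.prems IH assms(2) by (intro mult_mono) auto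
    show "cmod (case k of 0 \<Rightarrow> 0 | Suc j \<Rightarrow> coeff ?P j) \<le> (1 + B) ^ n"
      using IH assms(2) by (auto split: nat.split)
  qed
  finally show ?case by (simp add: algebra_simps)
qed

lemma finite_bounded_int_polys:
  "finite {f :: int poly. degree f \<le> n \<and> (\<forall>k. \<bar>coeff f k\<bar> \<le> C)}"
proof (rule finite_subset)
  show "{f. degree f \<le> n \<and> (\<forall>k. \<bar>coeff f k\<bar> \<le> C)}
      \<subseteq> Poly ` {xs. set xs \<subseteq> {-C..C} \<and> length xs = Suc n}"
  proof
    fix f :: "int poly"
    assume f: "f \<in> {f. degree f \<le> n \<and> (\<forall>k. \<bar>coeff f k\<bar> \<le> C)}"
    have "f = Poly (map (coeff f) [0..<Suc n])"
      using f by (intro poly_eqI) (auto simp: coeff_Poly_eq nth_default_def coeff_eq_0 simp del: upt_Suc)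
    moreover have "- C \<le> coeff f k \<and> coeff f k \<le> C" for k
    proof -
      have "\<bar>coeff f k\<bar> \<le> C" using f by blast
      then show ?thesis by linarith
    qed
    then have "set (map (coeff f) [0..<Suc n]) \<subseteq> {-C..C}" by auto
    ultimately show "f \<in> Poly ` {xs. set xs \<subseteq> {-C..C} \<and> length xs = Suc n}"
      by (metis (mono_tags, lifting) imageI length_map length_upt mem_Collect_eq minus_nat.diff_0)
  qed
  show "finite (Poly ` {xs. set xs \<subseteq> {-C..C} \<and> length xs = Suc n})"
    by (intro finite_imageI finite_lists_length_eq) auto
qed

text \<open>Northcott-type finiteness: a bound on the zeroes bounds the coefficients, and these are
  integers.\<close>

lemma finite_monic_house_le:
  assumes "n > 0"
  shows "finite {f. lead_coeff f = 1 \<and> degree f = n \<and> house f \<le> B}"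
proof (rule finite_subset[OF _ finite_bounded_int_polys[of n "\<lceil>(1 + B) ^ n\<rceil>"]], safe)
  fix f k
  assume f: "lead_coeff f = 1" "n = degree f" "house f \<le> B"
  obtain \<alpha> where \<alpha>: "cpoly f = (\<Prod>i<degree f. [:- \<alpha> i, 1:])"
      "\<And>i. i < degree f \<Longrightarrow> poly (cpoly f) (\<alpha> i) = 0"
    using cpoly_linear_factors[OF f(1)] by metis
  have B: "0 \<le> B" using house_nonneg[of f] assms f by linarith
  have "cmod (\<alpha> i) \<le> B" if "i < degree f" for i
    using norm_root_le_house[of f "\<alpha> i"] \<alpha>(2)[OF that] f by force
  then have "cmod (coeff (cpoly f) k) \<le> (1 + B) ^ degree f"
    unfolding \<alpha>(1) using B by (intro norm_coeff_prod_linear_le)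
  then have "real_of_int \<bar>coeff f k\<bar> \<le> (1 + B) ^ degree f"
    by (simp add: coeff_map_poly)
  then show "\<bar>coeff f k\<bar> \<le> \<lceil>(1 + B) ^ degree f\<rceil>" by linarith
qed

definition houses_gt_1 :: "(int poly \<Rightarrow> bool) \<Rightarrow> nat \<Rightarrow> real set" where
  "houses_gt_1 P n = {x. x > 1 \<and> (\<exists>f. lead_coeff f = 1 \<and> degree f = n \<and> P f \<and> x = house f)}"

lemma houses_gt_1I:
  "lead_coeff f = 1 \<Longrightarrow> degree f = n \<Longrightarrow> P f \<Longrightarrow> house f > 1 \<Longrightarrow> house f \<in> houses_gt_1 P n"
  by (auto simp: houses_gt_1_def)

text \<open>On the reals \<open>LEAST\<close> is meaningful only if a minimum exists. It does here
  because only finitely many of these houses do not exceed a given one.\<close>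

lemma Least_houses_gt_1:
  assumes "n > 0" "B \<in> houses_gt_1 P n"
  shows "(LEAST x. x \<in> houses_gt_1 P n) \<in> houses_gt_1 P n" "(LEAST x. x \<in> houses_gt_1 P n) \<le> B"
proof -
  let ?S = "houses_gt_1 P n"
  let ?T = "{x \<in> ?S. x \<le> B}"
  have "?T \<subseteq> house ` {f. lead_coeff f = 1 \<and> degree f = n \<and> house f \<le> B}"
    unfolding houses_gt_1_def by auto
  then have fin: "finite ?T"
    using finite_monic_house_le[OF \<open>n > 0\<close>] finite_subset by blast
  have T: "Min ?T \<in> ?T" using fin assms(2) by (intro Min_in) auto
  have min: "Min ?T \<le> x" if "x \<in> ?S" for x
  proof (cases "x \<le> B")
    case True
    then show ?thesis using that fin by (intro Min_le) auto
  next
    case False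
    then show ?thesis using T by auto
  qed
  have eq: "(LEAST x. x \<in> ?S) = Min ?T" using T min by (intro Least_equality) auto
  show "(LEAST x. x \<in> ?S) \<in> ?S" unfolding eq using T by blast
  show "(LEAST x. x \<in> ?S) \<le> B" unfolding eq using min assms(2) by blast
qed

subsection \<open>Irreducible factors\<close>

text \<open>Among the monic divisors of \<open>f\<close> vanishing at \<open>z\<close>, one of least
  degree is irreducible: in any factorization one factor vanishes at \<open>z\<close>, so by
  minimality the other is constant, equal to \<open>1\<close> or \<open>-1\<close>.\<close>

lemma exists_monic_irreducible_factor:
  fixes f :: "int poly"
  assumes "lead_coeff f = 1" "poly (cpoly f) z = 0"
  obtains p where "irreducible p" "lead_coeff p = 1" "p dvd f" "poly (cpoly p) z = 0"
proof -
  define Q where "Q p \<longleftrightarrow> lead_coeff p = 1 \<and> p dvd f \<and> poly (cpoly p) z = 0" for p :: "int poly"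
  have "Q f" using assms by (simp add: Q_def)
  then obtain p where p: "Q p" and min: "\<And>q. Q q \<Longrightarrow> degree p \<le> degree q"
    using ex_has_least_nat[of Q f degree] by metis
  have unit: "b dvd 1" if ab: "p = a * b" and a: "poly (cpoly a) z = 0" for a b
  proof -
    have lc: "lead_coeff a * lead_coeff b = 1" using p ab by (simp add: Q_def lead_coeff_mult)
    then have l: "lead_coeff a = 1 \<and> lead_coeff b = 1 \<or> lead_coeff a = -1 \<and> lead_coeff b = -1"
      by (simp add: zmult_eq_1_iff)
    have "Q (smult (lead_coeff a) a)"
      using l p ab a by (auto simp: Q_def cpoly_smult intro: dvd_trans[of a p f])
    then have "degree p \<le> degree a" using min l by fastforce
    moreover have "degree p = degree a + degree b"
      using ab p by (auto simp: Q_def intro!: degree_mult_eq)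
    ultimately have "degree b = 0" by simp
    then obtain c where "b = [:c:]" by (rule degree_eq_zeroE)
    then show ?thesis using l by (auto simp: is_unit_const_poly_iff)
  qed
  have "irreducible p"
  proof (rule irreducibleI)
    show "p \<noteq> 0" using p by (auto simp: Q_def)
    show "\<not> p dvd 1"
    proof
      assume "p dvd 1"
      then have "poly (cpoly 1) z = 0" using p poly_cpoly_dvd unfolding Q_def by blast
      then show False by (simp add: one_pCons map_poly_pCons)
    qed
    fix a b assume ab: "p = a * b"
    then have "poly (cpoly a) z = 0 \<or> poly (cpoly b) z = 0"
      using p by (simp add: Q_def cpoly_mult)
    then show "a dvd 1 \<or> b dvd 1" using unit[of a b] unit[of b a] ab by (auto simp: mult.commute)
  qed
  then show ?thesis using that p by (auto simp: Q_def)
qed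

lemma exists_irreducible_factor_same_house:
  fixes f :: "int poly"
  assumes "lead_coeff f = 1" "0 < degree f"
  obtains p where "irreducible p" "lead_coeff p = 1" "p dvd f" "0 < degree p" "degree p \<le> degree f"
    "house p = house f"
proof -
  obtain z where z: "poly (cpoly f) z = 0" "cmod z = house f"
    using house_attained[OF assms(2)] .
  obtain p where p: "irreducible p" "lead_coeff p = 1" "p dvd f" "poly (cpoly p) z = 0"
    using exists_monic_irreducible_factor[OF assms(1) z(1)] .
  have f0: "f \<noteq> 0" and p0: "p \<noteq> 0" using assms(1) p(2) by auto
  show ?thesis
    using that[OF p(1-3) degree_pos_of_root[OF p0 p(4)] dvd_imp_degree_le[OF p(3) f0]]
      house_eq_of_dvd[OF p(3) f0 p(4) z(2)] .
qed

text \<open>The minimal polynomial argument, kept over the integers by pseudo-division. A nonzero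
  \<open>m\<close> of least degree vanishing at \<open>z\<close> satisfies \<open>c f = m q\<close>;
  the prime \<open>f\<close> divides \<open>m\<close>, since dividing \<open>q\<close> would make
  \<open>m\<close> constant. Hence \<open>f\<close> has least degree too, and pseudo-division by the
  monic \<open>f\<close> is exact division.\<close>

lemma irreducible_dvd_of_common_root:
  fixes f g :: "int poly"
  assumes irr: "irreducible f" and monic: "lead_coeff f = 1"
    and f0: "poly (cpoly f) z = 0" and g0: "poly (cpoly g) z = 0"
  shows "f dvd g"
proof -
  define Q where "Q m \<longleftrightarrow> m \<noteq> 0 \<and> poly (cpoly m) z = 0" for m :: "int poly"
  have "Q f" using f0 monic by (auto simp: Q_def)
  then obtain m where m: "Q m" and min: "\<And>q. Q q \<Longrightarrow> degree m \<le> degree q"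
    using ex_has_least_nat[of Q f degree] by metis
  have rem: "snd (pseudo_divmod h k) = 0"
    if "poly (cpoly h) z = 0" "Q k" "degree k \<le> degree m" for h k
  proof -
    obtain q r where qr: "pseudo_divmod h k = (q, r)" by fastforce
    have "k \<noteq> 0" using that by (simp add: Q_def)
    note * = pseudo_divmod[OF this qr]
    have "poly (cpoly (smult (coeff k (degree k) ^ (Suc (degree h) - degree k)) h)) z
        = poly (cpoly (k * q + r)) z"
      by (simp only: *(1))
    then have "poly (cpoly r) z = 0"
      using that by (simp add: cpoly_smult cpoly_add cpoly_mult Q_def)
    then have "r = 0" using *(2) min[of r] that(3) by (force simp: Q_def)
    then show ?thesis by (simp add: qr)
  qed
  have m0: "m \<noteq> 0" using m by (simp add: Q_def)
  obtain q where q: "pseudo_divmod f m = (q, 0)"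
    using rem[OF f0 m] by (metis le_refl prod.collapse)
  define c where "c = lead_coeff m ^ (Suc (degree f) - degree m)"
  have c: "smult c f = m * q" using pseudo_divmod(1)[OF m0 q] by (simp add: c_def)
  have c0: "c \<noteq> 0" using m0 by (simp add: c_def)
  have "prime_elem f" using irr by (rule irreducible_imp_prime_elem)
  moreover have "f dvd m * q" unfolding c[symmetric] by (simp add: dvd_smult)
  ultimately have "f dvd m \<or> f dvd q" by (simp add: prime_elem_dvd_mult_iff)
  then have fm: "f dvd m"
  proof
    assume "f dvd q"
    then obtain h where "q = f * h" ..
    then have "f * [:c:] = f * (m * h)" using c by (simp add: mult_ac)
    then have "m * h = [:c:]" using monic by (auto simp del: mult_pCons_right)
    moreover from this have "h \<noteq> 0" using c0 by auto
    ultimately have "degree m = 0" using m0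
      by (metis add_eq_0_iff_both_eq_0 degree_mult_eq degree_pCons_0)
    then show ?thesis using m degree_pos_of_root[of m z] by (simp add: Q_def)
  qed
  then have "degree f \<le> degree m" using m0 by (rule dvd_imp_degree_le)
  then obtain q where q: "pseudo_divmod g f = (q, 0)"
    using rem[OF g0 \<open>Q f\<close>] by (metis prod.collapse)
  have "f \<noteq> 0" using monic by auto
  from pseudo_divmod(1)[OF this q] show ?thesis using monic by simp
qed

subsection \<open>Houses of non-reciprocal polynomials\<close>

text \<open>A form of Smyth's argument. The product of the zeroes outside the unit circle has
  modulus \<open>cmod (W 0)\<close>, and the maximum modulus principle, applied to a function built
  from \<open>f + g\<close> and \<open>f - g\<close>, bounds it from below.\<close>

lemma house_power_ge_of_not_self_reflecting:
  fixes f :: "int poly"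
  assumes monic: "lead_coeff f = 1" and const: "\<bar>coeff f 0\<bar> = 1" and big: "1 \<le> house f"
    and no_unimodular: "\<And>z. poly (cpoly f) z = 0 \<Longrightarrow> cmod z \<noteq> 1"
    and neq: "f \<noteq> smult (coeff f 0) (reflect_poly f)"
  shows "5 / 4 \<le> (house f ^ degree f)\<^sup>2"
proof -
  define \<epsilon> where "\<epsilon> = coeff f 0"
  have \<epsilon>: "\<epsilon> * \<epsilon> = 1" using const by (auto simp: \<epsilon>_def abs_if split: if_splits)
  have \<epsilon>_norm: "cmod (of_int \<epsilon>) = 1" using const by (simp add: \<epsilon>_def flip: of_int_abs)
  \<comment> \<open>The factor \<open>\<epsilon>\<close> gives \<open>g\<close> the same constant
    coefficient as \<open>f\<close>, so \<open>f + g\<close> takes the value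
    \<open>2 * \<epsilon>\<close> at the origin.\<close>
  define g where "g = smult \<epsilon> (reflect_poly f)"
  have g0: "coeff g 0 = \<epsilon>" using monic by (simp add: g_def)
  have "f - g \<noteq> 0" using neq by (simp add: g_def \<epsilon>_def)
  \<comment> \<open>Removing the power of \<open>t\<close> leaves a nonzero integer
    \<open>coeff E 0\<close> and changes no modulus on the unit circle.\<close>
  then obtain k E where kE: "f - g = [:0, 1:] ^ k * E" and "\<not> [:0, 1:] dvd E"
    using order_decomp[of "f - g" 0] by auto
  then have E0: "coeff E 0 \<noteq> 0"
    using poly_eq_0_iff_dvd[of E 0] by (simp add: poly_0_coeff_0)
  have f0: "f \<noteq> 0" using monic by auto

  obtain \<alpha> where \<alpha>: "\<And>z. poly (cpoly f) z = (\<Prod>i<degree f. z - \<alpha> i)"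
      "\<And>i. i < degree f \<Longrightarrow> poly (cpoly f) (\<alpha> i) = 0"
    using cpoly_linear_factors[OF monic] by metis
  \<comment> \<open>Zeroes in the open disc are reflected in the unit circle:
    \<open>1 - cnj (\<alpha> i) * z\<close> has the modulus of \<open>z - \<alpha> i\<close> on the
    circle and no zero in the closed disc, and it contributes 1 at the origin.\<close>
  define w where "w i z = (if cmod (\<alpha> i) < 1 then 1 - cnj (\<alpha> i) * z else z - \<alpha> i)" for i z
  define W where "W z = (\<Prod>i<degree f. w i z)" for z
  have W_nz: "W z \<noteq> 0" if "cmod z \<le> 1" for z
  proof -
    have "w i z \<noteq> 0" if i: "i < degree f" for i
    proof (cases "cmod (\<alpha> i) < 1")
      case True
      then have "cmod (cnj (\<alpha> i) * z) < 1"
        using \<open>cmod z \<le> 1\<close> mult_left_le[of "cmod z" "cmod (\<alpha> i)"] by (simp add: norm_mult)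
      then show ?thesis using True by (auto simp: w_def)
    next
      case False
      then have "cmod (\<alpha> i) > 1" using no_unimodular[OF \<alpha>(2)[OF i]] by simp
      then show ?thesis using False \<open>cmod z \<le> 1\<close> by (auto simp: w_def)
    qed
    then show ?thesis by (simp add: W_def)
  qed
  have W_circle: "cmod (W z) = cmod (poly (cpoly f) z)" if z: "cmod z = 1" for z
  proof -
    have "cmod (1 - cnj (\<alpha> i) * z) = cmod (z - \<alpha> i)" for i
    proof -
      have "z * cnj z = 1" using z by (simp add: complex_norm_square[symmetric])
      then have "1 - cnj (\<alpha> i) * z = z * cnj (z - \<alpha> i)" by (simp add: algebra_simps)
      then show ?thesis using z by (simp only: norm_mult complex_mod_cnj mult_1_left)
    qed
    then show ?thesis unfolding W_def \<alpha>(1) by (auto simp: w_def simp flip: prod_norm intro!: prod.cong)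
  qed
  have W0: "cmod (W 0) \<le> house f ^ degree f"
  proof -
    have "cmod (w i 0) \<le> house f" if "i < degree f" for i
      using norm_root_le_house[OF f0 \<alpha>(2)[OF that]] big by (simp add: w_def)
    then have "(\<Prod>i<degree f. cmod (w i 0)) \<le> (\<Prod>i<degree f. house f)"
      by (intro prod_mono) auto
    then show ?thesis by (simp add: W_def prod_norm[symmetric])
  qed
  have g_circle: "cmod (poly (cpoly g) z) = cmod (poly (cpoly f) z)" if z: "cmod z = 1" for z
  proof -
    have "z \<noteq> 0" using z by auto
    moreover have "inverse z = cnj z" using z by (simp add: inverse_complex.code complex_eq_iff cmod_def)
    ultimately have "poly (cpoly g) z = of_int \<epsilon> * (z ^ degree f * cnj (poly (cpoly f) z))"
      by (simp add: g_def cpoly_smult cpoly_reflect poly_reflect_poly_nz degree_cpoly poly_cpoly_cnj)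
    then show ?thesis using z \<epsilon>_norm by (simp only: norm_mult norm_power complex_mod_cnj) simp
  qed

  \<comment> \<open>By the parallelogram law the two squares have total modulus at most 1 on the unit circle;
    the quotient by \<open>z ^ k\<close> makes the second one nonzero at the origin.\<close>
  define F where "F z = (poly (cpoly (f + g)) z / (2 * W z))\<^sup>2 + (poly (cpoly E) z / (2 * W z))\<^sup>2" for z
  have F_circle: "cmod (F z) \<le> 1" if z: "cmod z = 1" for z
  proof -
    let ?a = "poly (cpoly f) z" and ?b = "poly (cpoly g) z"
    have "cmod (poly (cpoly E) z) = cmod (?a - ?b)"
    proof -
      have "poly (cpoly (f - g)) z = z ^ k * poly (cpoly E) z"
        unfolding kE by (simp add: cpoly_mult cpoly_power map_poly_pCons)
      then show ?thesis using z by (simp add: cpoly_diff norm_mult norm_power)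
    qed
    then have "cmod (F z) \<le> (cmod (?a + ?b) / (2 * cmod ?a))\<^sup>2 + (cmod (?a - ?b) / (2 * cmod ?a))\<^sup>2"
      unfolding F_def using W_circle[OF z]
      by (intro norm_triangle_le) (simp add: norm_power norm_divide norm_mult cpoly_add)
    also have "\<dots> = ((cmod (?a + ?b))\<^sup>2 + (cmod (?a - ?b))\<^sup>2) / (4 * (cmod ?a)\<^sup>2)"
      by (simp add: power_divide power_mult_distrib add_divide_distrib)
    also have "(cmod (?a + ?b))\<^sup>2 + (cmod (?a - ?b))\<^sup>2 = 2 * (cmod ?a)\<^sup>2 + 2 * (cmod ?b)\<^sup>2"
      by (simp only: cmod_power2) (simp add: power2_eq_square algebra_simps)
    also have "(2 * (cmod ?a)\<^sup>2 + 2 * (cmod ?b)\<^sup>2) / (4 * (cmod ?a)\<^sup>2) = 1"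
      using g_circle[OF z] no_unimodular[of z] z by auto
    finally show ?thesis .
  qed
  have "w i holomorphic_on cball 0 1" for i
    by (cases "cmod (\<alpha> i) < 1") (auto simp: w_def[abs_def] intro!: holomorphic_intros)
  then have "W holomorphic_on cball 0 1"
    unfolding W_def[abs_def] by (intro holomorphic_intros)
  then have hol: "F holomorphic_on cball 0 1"
    unfolding F_def[abs_def] by (intro holomorphic_intros) (simp_all add: W_nz)
  have "cmod (F 0) \<le> 1"
  proof (rule maximum_modulus_frontier[of F "cball 0 1"])
    show "F holomorphic_on interior (cball 0 1)"
      using hol interior_subset by (rule holomorphic_on_subset)
    show "continuous_on (closure (cball 0 1)) F"
      using hol by (simp add: holomorphic_on_imp_continuous_on)
    show "cmod (F z) \<le> 1" if "z \<in> frontier (cball 0 1)" for z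
      using that by (intro F_circle) simp
  qed simp_all
  moreover have "F 0 = (4 + of_int ((coeff E 0)\<^sup>2)) / (4 * (W 0)\<^sup>2)"
  proof -
    have "coeff (f + g) 0 = 2 * \<epsilon>" using g0 by (simp add: \<epsilon>_def)
    then have "(poly (cpoly (f + g)) 0)\<^sup>2 = of_int ((2 * \<epsilon>)\<^sup>2)"
      by (simp only: poly_cpoly_0 of_int_power)
    also have "(2 * \<epsilon>)\<^sup>2 = 4" using \<epsilon> by (simp add: power2_eq_square)
    finally have sq: "(poly (cpoly (f + g)) 0)\<^sup>2 = 4" by simp
    have "F 0 = ((poly (cpoly (f + g)) 0)\<^sup>2 + (poly (cpoly E) 0)\<^sup>2) / (2 * W 0)\<^sup>2"
      by (simp only: F_def power_divide add_divide_distrib)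
    then show ?thesis unfolding sq by (simp add: poly_cpoly_0 power_mult_distrib)
  qed
  ultimately have le1: "cmod (4 + of_int ((coeff E 0)\<^sup>2)) / (4 * (cmod (W 0))\<^sup>2) \<le> 1"
    by (simp add: norm_divide norm_mult norm_power)
  \<comment> \<open>The square of a nonzero integer is at least 1, so the numerator of
    \<open>F 0\<close> is at least \<open>4 + 1\<close>; this is the source of
    \<open>5 / 4\<close>.\<close>
  have "(coeff E 0)\<^sup>2 \<ge> 1" using E0 by (simp add: int_one_le_iff_zero_less)
  then have "(5::real) \<le> 4 + of_int ((coeff E 0)\<^sup>2)" by linarith
  also have "\<dots> \<le> cmod (4 + of_int ((coeff E 0)\<^sup>2))"
    using complex_Re_le_cmod[of "4 + of_int ((coeff E 0)\<^sup>2)"] by simp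
  finally have "5 \<le> 4 * (cmod (W 0))\<^sup>2" using le1 W_nz[of 0] by (simp add: divide_simps split: if_splits)
  moreover have "(cmod (W 0))\<^sup>2 \<le> (house f ^ degree f)\<^sup>2" using W0 by (intro power_mono) auto
  ultimately show ?thesis by linarith
qed

text \<open>Up to sign, the constant coefficient is the product of the zeroes.\<close>

lemma house_power_ge_abs_coeff_0:
  assumes "lead_coeff f = 1"
  shows "real_of_int \<bar>coeff f 0\<bar> \<le> house f ^ degree f"
proof -
  have f0: "f \<noteq> 0" using assms by auto
  obtain \<alpha> where \<alpha>: "\<And>z. poly (cpoly f) z = (\<Prod>i<degree f. z - \<alpha> i)"
      "\<And>i. i < degree f \<Longrightarrow> poly (cpoly f) (\<alpha> i) = 0"
    using cpoly_linear_factors[OF assms] by metis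
  have "real_of_int \<bar>coeff f 0\<bar> = cmod (poly (cpoly f) 0)" by (simp add: poly_cpoly_0)
  also have "\<dots> = (\<Prod>i<degree f. cmod (\<alpha> i))" by (simp add: \<alpha>(1) prod_norm[symmetric])
  also have "\<dots> \<le> (\<Prod>i<degree f. house f)"
    using norm_root_le_house[OF f0 \<alpha>(2)] by (intro prod_mono) auto
  finally show ?thesis by simp
qed

text \<open>Such a zero would make \<open>f\<close> divide \<open>t - a\<close>, whose only zero has
  modulus at most 1. Applied below to \<open>0\<close> and \<open>1\<close>.\<close>

lemma irreducible_no_small_int_root:
  fixes f :: "int poly"
  assumes "irreducible f" "lead_coeff f = 1" "house f > 1" "\<bar>a\<bar> \<le> 1"
  shows "poly (cpoly f) (of_int a) \<noteq> 0"
proof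
  assume "poly (cpoly f) (of_int a) = 0"
  then have dvd: "f dvd [:-a, 1:]"
    using irreducible_dvd_of_common_root[OF assms(1,2)] by (simp add: map_poly_pCons)
  have "f \<noteq> 0" using assms(2) by auto
  then have "degree f > 0" using \<open>poly (cpoly f) (of_int a) = 0\<close> by (rule degree_pos_of_root)
  then obtain z where z: "poly (cpoly f) z = 0" "cmod z = house f" by (rule house_attained)
  have "z = of_int a" using poly_cpoly_dvd[OF dvd z(1)] by (simp add: map_poly_pCons)
  then have "cmod z = of_int \<bar>a\<bar>" by simp
  then show False using z(2) assms(3,4) by linarith
qed

text \<open>If the constant coefficient has modulus at least 2, the product of the zeroes is large.
  If \<open>f\<close> is its own reflection up to sign, the sign \<open>-1\<close> would give the
  zero \<open>1\<close>, so \<open>f\<close> is reciprocal. In the remaining case the analytic bound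
  applies.\<close>

lemma reciprocal_or_house_large:
  fixes f :: "int poly"
  assumes irr: "irreducible f" and monic: "lead_coeff f = 1" and big: "house f > 1"
  shows "reciprocal f \<or> ln (5 / 4) / 2 \<le> degree f * ln (house f)"
proof -
  have "reciprocal f \<or> 5 / 4 \<le> (house f ^ degree f)\<^sup>2"
  proof (cases "\<bar>coeff f 0\<bar> = 1")
    case False
    have "coeff f 0 \<noteq> 0"
      using irreducible_no_small_int_root[OF irr monic big, of 0] by (simp add: poly_cpoly_0)
    then have "2 \<le> \<bar>coeff f 0\<bar>" using False by linarith
    then have "2 \<le> house f ^ degree f" using house_power_ge_abs_coeff_0[OF monic] by linarith
    then have "2\<^sup>2 \<le> (house f ^ degree f)\<^sup>2" by (intro power_mono) auto
    then show ?thesis by simp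
  next
    case const: True
    show ?thesis
    proof (cases "f = smult (coeff f 0) (reflect_poly f)")
      case eq: True
      have "coeff f 0 \<noteq> -1"
      proof
        assume "coeff f 0 = -1"
        then have "cpoly f = - reflect_poly (cpoly f)"
          by (subst eq) (simp add: cpoly_minus cpoly_reflect)
        then have "poly (cpoly f) 1 = - poly (reflect_poly (cpoly f)) 1" by (metis poly_minus)
        also have "poly (reflect_poly (cpoly f)) 1 = poly (cpoly f) 1"
          by (simp add: poly_reflect_poly_nz)
        finally show False using irreducible_no_small_int_root[OF irr monic big, of 1] by simp
      qed
      then have "coeff f 0 = 1" using const by linarith
      then show ?thesis using eq by (simp add: reciprocal_def)
    next
      case neq: False
      \<comment> \<open>On the unit circle the inverse is the conjugate, so a zero there is also a
        zero of the reflection; irreducibility then makes the reflection a constant multiple of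
        \<open>f\<close>, against \<open>neq\<close>.\<close>
      have "cmod z \<noteq> 1" if z: "poly (cpoly f) z = 0" for z
      proof
        assume "cmod z = 1"
        then have "z \<noteq> 0" "inverse z = cnj z"
          by (auto simp: inverse_complex.code complex_eq_iff cmod_def)
        then have "poly (cpoly (reflect_poly f)) z = 0"
          using z by (simp add: cpoly_reflect poly_reflect_poly_nz poly_cpoly_cnj)
        then have "f dvd reflect_poly f"
          using irreducible_dvd_of_common_root[OF irr monic z] by blast
        then obtain h where h: "reflect_poly f = f * h" ..
        have "coeff f 0 \<noteq> 0" using const by auto
        then have "degree (f * h) = degree f" using h degree_reflect_poly_eq by metis
        moreover have "h \<noteq> 0" "f \<noteq> 0" using h monic by auto
        ultimately have "degree h = 0" by (simp add: degree_mult_eq)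
        then obtain c where "h = [:c:]" by (rule degree_eq_zeroE)
        then have fc: "reflect_poly f = smult c f" using h by simp
        then have "1 = c * coeff f 0" using monic by (metis coeff_0_reflect_poly coeff_smult)
        then have "smult (coeff f 0) (reflect_poly f) = f" using fc by (simp add: mult.commute)
        then show False using neq by simp
      qed
      then show ?thesis
        using house_power_ge_of_not_self_reflecting[OF monic const _ _ neq] big by auto
    qed
  qed
  moreover have "ln (5 / 4) / 2 \<le> degree f * ln (house f)" if "5 / 4 \<le> (house f ^ degree f)\<^sup>2"
  proof -
    have "ln (5 / 4) \<le> ln ((house f ^ degree f)\<^sup>2)" using that big by (subst ln_le_cancel_iff) auto
    also have "\<dots> = 2 * (degree f * ln (house f))" using big by (simp add: ln_realpow)
    finally show ?thesis by simp
  qed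
  ultimately show ?thesis by blast
qed

subsection \<open>Reciprocal and skew-reciprocal polynomials\<close>

text \<open>\<open>monom 1 2\<close> is \<open>t^2\<close>. This substitution doubles the degree and
  takes square roots of the zeroes, so the degree times the logarithm of a house greater than 1 is
  unchanged.\<close>

lemma coeff_pcompose_square:
  fixes f :: "'a::comm_semiring_1 poly"
  shows "coeff (f \<circ>\<^sub>p monom 1 2) n = (if even n then coeff f (n div 2) else 0)"
proof (induction f arbitrary: n)
  case (pCons a f)
  show ?case
  proof (cases "n < 2")
    case True
    then have "n = 0 \<or> n = 1" by auto
    then show ?thesis by (auto simp: pcompose_pCons coeff_monom_mult coeff_pCons)
  next
    case False
    then obtain m where "n = m + 2" by (metis add.commute le_Suc_ex not_less)
    then show ?thesis by (simp add: pcompose_pCons coeff_monom_mult coeff_pCons pCons.IH)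
  qed
qed simp

lemma degree_pcompose_square: "degree (f \<circ>\<^sub>p monom 1 2) = 2 * degree f" for f :: "int poly"
  by (simp add: degree_pcompose degree_monom_eq)

lemma lead_coeff_pcompose_square: "lead_coeff (f \<circ>\<^sub>p monom 1 2) = lead_coeff f" for f :: "int poly"
  by (simp add: degree_pcompose_square coeff_pcompose_square)

text \<open>Reflection commutes with substituting \<open>t^2\<close>, and the substitution is
  injective.\<close>

lemma reciprocal_pcompose_square_iff: "reciprocal (f \<circ>\<^sub>p monom 1 2) \<longleftrightarrow> reciprocal f"
proof -
  have "coeff (reflect_poly (f \<circ>\<^sub>p monom 1 2)) n = coeff (reflect_poly f \<circ>\<^sub>p monom 1 2) n" for n
    by (auto simp: coeff_pcompose_square coeff_reflect_poly degree_pcompose_square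
        simp flip: right_diff_distrib' elim!: evenE)
  then have "reflect_poly (f \<circ>\<^sub>p monom 1 2) = reflect_poly f \<circ>\<^sub>p monom 1 2"
    by (rule poly_eqI)
  moreover have "f \<circ>\<^sub>p monom 1 2 = g \<circ>\<^sub>p monom 1 2 \<longleftrightarrow> f = g" for g
  proof
    assume eq: "f \<circ>\<^sub>p monom 1 2 = g \<circ>\<^sub>p monom 1 2"
    show "f = g"
    proof (rule poly_eqI)
      fix n show "coeff f n = coeff g n"
        using arg_cong[OF eq, of "\<lambda>h. coeff h (2 * n)"] by (simp add: coeff_pcompose_square)
    qed
  qed simp
  ultimately show ?thesis by (simp add: reciprocal_def)
qed

text \<open>\<open>f(t^2)\<close> is unchanged by \<open>t -> -t\<close>, and half its degree is
  \<open>degree f\<close>, whose evenness makes the sign \<open>+1\<close>.\<close>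

lemma skew_reciprocal_pcompose_square:
  assumes "reciprocal f" "even (degree f)"
  shows "skew_reciprocal (f \<circ>\<^sub>p monom 1 2)"
proof -
  let ?g = "f \<circ>\<^sub>p monom 1 2"
  have "coeff (?g \<circ>\<^sub>p [:0, -1:]) n = coeff ?g n" for n
    by (simp add: coeff_pcompose_linear coeff_pcompose_square)
  then have "?g \<circ>\<^sub>p [:0, -1:] = ?g" by (rule poly_eqI)
  moreover have "?g = reflect_poly ?g"
    using assms(1) reciprocal_pcompose_square_iff by (simp add: reciprocal_def)
  ultimately show ?thesis using assms(2) by (simp add: skew_reciprocal_def degree_pcompose_square)
qed

lemma house_pcompose_square:
  assumes "degree f > 0"
  shows "house (f \<circ>\<^sub>p monom 1 2) = sqrt (house f)"
proof -
  let ?g = "f \<circ>\<^sub>p monom 1 2"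
  have ev: "poly (cpoly ?g) z = poly (cpoly f) (z\<^sup>2)" for z
    by (simp add: cpoly_pcompose cpoly_monom poly_pcompose poly_monom)
  have deg: "degree ?g > 0" using assms by (simp add: degree_pcompose_square)
  have nz: "f \<noteq> 0" "?g \<noteq> 0" using assms deg by (metis degree_0 less_irrefl)+
  have "house ?g \<le> sqrt (house f)"
  proof (rule house_le[OF deg])
    fix z assume "poly (cpoly ?g) z = 0"
    then have "(cmod z)\<^sup>2 \<le> house f"
      using norm_root_le_house[OF nz(1), of "z\<^sup>2"] by (simp add: ev norm_power)
    then show "cmod z \<le> sqrt (house f)" by (rule real_le_rsqrt)
  qed
  moreover obtain z where z: "poly (cpoly f) z = 0" "cmod z = house f"
    using house_attained[OF assms] by blast
  have "sqrt (cmod z) \<le> house ?g"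
    using norm_root_le_house[OF nz(2), of "csqrt z"] z by (simp add: ev norm_csqrt)
  ultimately show ?thesis using z(2) by simp
qed

lemma even_poly_eq_pcompose_square:
  fixes p :: "int poly"
  assumes "\<And>n. odd n \<Longrightarrow> coeff p n = 0"
  obtains u where "p = u \<circ>\<^sub>p monom 1 2"
proof -
  define u where "u = (\<Sum>k\<le>degree p. monom (coeff p (2 * k)) k)"
  have "coeff u k = coeff p (2 * k)" for k
    by (auto simp: u_def coeff_sum coeff_eq_0)
  then have "p = u \<circ>\<^sub>p monom 1 2"
    using assms by (intro poly_eqI) (auto simp: coeff_pcompose_square)
  then show ?thesis by (rule that)
qed

lemma reciprocal_mult: "reciprocal f \<Longrightarrow> reciprocal g \<Longrightarrow> reciprocal (f * g)"
  by (simp add: reciprocal_def reflect_poly_mult)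

text \<open>A power of \<open>t + 1\<close> is reciprocal and can add only the zero
  \<open>-1\<close>, of modulus below the house of \<open>f\<close>.\<close>

lemma reciprocal_pad:
  assumes f: "lead_coeff f = 1" "reciprocal f" "house f > 1" "0 < degree f" "degree f \<le> n"
  obtains g where "lead_coeff g = 1" "degree g = n" "reciprocal g" "house g = house f"
proof -
  define h :: "int poly" where "h = [:1, 1:] ^ (n - degree f)"
  have h: "lead_coeff h = 1" "degree h = n - degree f" "h \<noteq> 0"
    using lead_coeff_power[of "[:1, 1 :: int:]" "n - degree f"]
    by (simp_all add: h_def degree_power_eq)
  have "reciprocal h"
  proof -
    have "reflect_poly [:1, 1 :: int:] = [:1, 1:]" by (simp add: reflect_poly_pCons)
    then show ?thesis by (simp add: reciprocal_def h_def reflect_poly_power)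
  qed
  have f0: "f \<noteq> 0" using f by auto
  have deg: "degree (f * h) = n" using f h f0 by (simp add: degree_mult_eq)
  obtain z where z: "poly (cpoly f) z = 0" "cmod z = house f"
    using house_attained f(4) by blast
  have "house (f * h) = house f"
  proof (rule antisym)
    show "house (f * h) \<le> house f"
    proof (rule house_le)
      show "degree (f * h) > 0" using deg f by simp
      fix w assume "poly (cpoly (f * h)) w = 0"
      then have "poly (cpoly f) w = 0 \<or> w = -1"
        by (auto simp: cpoly_mult h_def cpoly_power map_poly_pCons add_eq_0_iff split: if_splits)
      then show "cmod w \<le> house f" using norm_root_le_house[OF f0] f(3) by auto
    qed
    show "house f \<le> house (f * h)"
      using norm_root_le_house[of "f * h" z] z f0 h by (simp add: cpoly_mult)
  qed
  then show ?thesis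
    using that[of "f * h"] f(1) h(1) deg reciprocal_mult[OF f(2) \<open>reciprocal h\<close>]
    by (metis lead_coeff_mult mult_1_left)
qed

subsection \<open>The extremal houses\<close>

lemma house_gt_1_of_root:
  assumes "f \<noteq> 0" "poly (cpoly f) (of_real x) = 0" "x > 1"
  shows "house f > 1"
  using norm_root_le_house[OF assms(1,2)] assms(3) by simp

text \<open>Makes the set under the \<open>LEAST\<close> of \<open>lambda_rec\<close> nonempty: a
  quadratic with zero \<open>(3 + sqrt 5) / 2\<close>, padded to degree \<open>n\<close>.\<close>

lemma exists_reciprocal_house_gt_1:
  assumes "n \<ge> 2"
  shows "\<exists>f. lead_coeff f = 1 \<and> degree f = n \<and> reciprocal f \<and> house f > 1"
proof -
  let ?f = "[:1, -3, 1 :: int:]"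
  have "reciprocal ?f" by (simp add: reciprocal_def reflect_poly_pCons)
  moreover have "house ?f > 1"
  proof (rule house_gt_1_of_root)
    define x where "x = (3 + sqrt 5) / 2"
    have "x * x - 3 * x + 1 = 0" by (simp add: x_def field_simps)
    then have "complex_of_real (x * x - 3 * x + 1) = 0" by (simp only: of_real_0)
    then show "poly (cpoly ?f) (of_real x) = 0"
      by (simp add: map_poly_pCons algebra_simps)
    show "x > 1" by (simp add: x_def add_pos_nonneg)
  qed simp
  ultimately obtain g where "lead_coeff g = 1" "degree g = n" "reciprocal g" "house g = house ?f"
    using assms by (elim reciprocal_pad[rotated, of ?f n]) simp_all
  then show ?thesis using \<open>house ?f > 1\<close> by (intro exI[of _ g]) simp
qed

lemma two_le_two_power: "i \<ge> 1 \<Longrightarrow> (2::nat) \<le> 2 ^ i"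
  using power_increasing[of 1 i "2::nat"] by simp

lemma lambda_rec_Least: "lambda_rec i = (LEAST x. x \<in> houses_gt_1 reciprocal (2 ^ i))"
  by (simp add: lambda_rec_def houses_gt_1_def)

lemma lambda_skew_Least: "lambda_skew i = (LEAST x. x \<in> houses_gt_1 skew_reciprocal (2 ^ i))"
  by (simp add: lambda_skew_def houses_gt_1_def)

lemma lambda_rec_attained:
  assumes "i \<ge> 1"
  obtains f where "lead_coeff f = 1" "degree f = 2 ^ i" "reciprocal f" "house f = lambda_rec i"
    "house f > 1"
proof -
  obtain g where "lead_coeff g = 1" "degree g = 2 ^ i" "reciprocal g" "house g > 1"
    using exists_reciprocal_house_gt_1[OF two_le_two_power[OF assms]] by blast
  then have "house g \<in> houses_gt_1 reciprocal (2 ^ i)" by (rule houses_gt_1I)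
  then have "lambda_rec i \<in> houses_gt_1 reciprocal (2 ^ i)"
    unfolding lambda_rec_Least by (rule Least_houses_gt_1(1)[rotated]) simp
  then obtain f where "lambda_rec i > 1" "lead_coeff f = 1" "degree f = 2 ^ i" "reciprocal f"
      "lambda_rec i = house f"
    unfolding houses_gt_1_def by blast
  then show ?thesis by (intro that[of f]) simp_all
qed

text \<open>Padding lets every positive degree up to \<open>2 ^ i\<close> compete.\<close>

lemma lambda_rec_le:
  assumes "lead_coeff f = 1" "reciprocal f" "house f > 1" "0 < degree f" "degree f \<le> 2 ^ i"
  shows "lambda_rec i \<le> house f"
proof -
  obtain g where g: "lead_coeff g = 1" "degree g = 2 ^ i" "reciprocal g" "house g = house f"
    using reciprocal_pad assms by blast
  then have "house g \<in> houses_gt_1 reciprocal (2 ^ i)" using assms(3) by (intro houses_gt_1I) auto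
  then show ?thesis
    unfolding lambda_rec_Least g(4) by (rule Least_houses_gt_1(2)[rotated]) simp
qed

text \<open>Degree 2 takes the golden ratio, a zero of \<open>t^2 - t - 1\<close>; higher degrees
  substitute \<open>t^2\<close> into a reciprocal polynomial of even degree.\<close>

lemma exists_skew_reciprocal_house_gt_1:
  assumes "i \<ge> 1"
  shows "\<exists>f. lead_coeff f = 1 \<and> degree f = 2 ^ i \<and> skew_reciprocal f \<and> house f > 1"
proof (cases "i = 1")
  case True
  let ?f = "[:-1, -1, 1 :: int:]"
  have "skew_reciprocal ?f"
    by (simp add: skew_reciprocal_def pcompose_pCons reflect_poly_pCons)
  moreover have "house ?f > 1"
  proof (rule house_gt_1_of_root)
    define x where "x = (1 + sqrt 5) / 2"
    have "x * x - x - 1 = 0" by (simp add: x_def field_simps)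
    then have "complex_of_real (x * x - x - 1) = 0" by (simp only: of_real_0)
    then show "poly (cpoly ?f) (of_real x) = 0"
      by (simp add: map_poly_pCons algebra_simps)
    show "x > 1" using real_sqrt_less_mono[of 1 5] by (simp add: x_def)
  qed simp
  ultimately show ?thesis using True by (intro exI[of _ ?f]) simp
next
  case False
  then have i: "i - 1 \<ge> 1" "(2::nat) ^ i = 2 * 2 ^ (i - 1)"
    using assms by (auto simp flip: power_Suc)
  obtain f where f: "lead_coeff f = 1" "degree f = 2 ^ (i - 1)" "reciprocal f" "house f > 1"
    using exists_reciprocal_house_gt_1[OF two_le_two_power[OF i(1)]] by blast
  show ?thesis
  proof (intro exI conjI)
    show "lead_coeff (f \<circ>\<^sub>p monom 1 2) = 1" using f(1) by (simp only: lead_coeff_pcompose_square)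
    show "degree (f \<circ>\<^sub>p monom 1 2) = 2 ^ i" by (simp only: degree_pcompose_square f(2) i(2))
    show "skew_reciprocal (f \<circ>\<^sub>p monom 1 2)"
      using f i(1) by (intro skew_reciprocal_pcompose_square) simp_all
    show "house (f \<circ>\<^sub>p monom 1 2) > 1" using f by (simp add: house_pcompose_square)
  qed
qed

lemma lambda_skew_attained:
  assumes "i \<ge> 1"
  obtains f where "lead_coeff f = 1" "degree f = 2 ^ i" "skew_reciprocal f"
    "house f = lambda_skew i" "house f > 1"
proof -
  obtain g where "lead_coeff g = 1" "degree g = 2 ^ i" "skew_reciprocal g" "house g > 1"
    using exists_skew_reciprocal_house_gt_1[OF assms] by blast
  then have "house g \<in> houses_gt_1 skew_reciprocal (2 ^ i)" by (rule houses_gt_1I)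
  then have "lambda_skew i \<in> houses_gt_1 skew_reciprocal (2 ^ i)"
    unfolding lambda_skew_Least by (rule Least_houses_gt_1(1)[rotated]) simp
  then obtain f where "lambda_skew i > 1" "lead_coeff f = 1" "degree f = 2 ^ i" "skew_reciprocal f"
      "lambda_skew i = house f"
    unfolding houses_gt_1_def by blast
  then show ?thesis by (intro that[of f]) simp_all
qed

lemma lambda_skew_le:
  assumes "lead_coeff f = 1" "skew_reciprocal f" "house f > 1" "degree f = 2 ^ i"
  shows "lambda_skew i \<le> house f"
  unfolding lambda_skew_Least
  using houses_gt_1I[of f "2 ^ i" skew_reciprocal] assms by (intro Least_houses_gt_1(2)) simp_all

lemma lambda_rec_gt_1: "i \<ge> 1 \<Longrightarrow> lambda_rec i > 1"
  by (erule lambda_rec_attained) simp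

lemma lambda_skew_gt_1: "i \<ge> 1 \<Longrightarrow> lambda_skew i > 1"
  by (erule lambda_skew_attained) simp

lemma r_seq_pos: "i \<ge> 1 \<Longrightarrow> r_seq i > 0"
  using lambda_rec_gt_1[of i] by (simp add: r_seq_def)

lemma s_seq_pos: "i \<ge> 1 \<Longrightarrow> s_seq i > 0"
  using lambda_skew_gt_1[of i] by (simp add: s_seq_def)

lemma r_seq_le:
  assumes "lead_coeff f = 1" "reciprocal f" "house f > 1" "0 < degree f" "degree f \<le> 2 ^ i" "i \<ge> 1"
  shows "r_seq i \<le> 2 ^ i * ln (house f)"
  using lambda_rec_le[OF assms(1-5)] lambda_rec_gt_1[OF assms(6)] by (simp add: r_seq_def)

text \<open>For an extremal reciprocal \<open>f\<close>, the polynomial \<open>f(t^2)\<close>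
  competes in both minima at \<open>Suc i\<close>, with twice the degree and half the logarithm of
  the house.\<close>

lemma seq_Suc_le_r_seq:
  assumes "i \<ge> 1"
  shows "r_seq (Suc i) \<le> r_seq i" "s_seq (Suc i) \<le> r_seq i"
proof -
  obtain f where f: "lead_coeff f = 1" "degree f = 2 ^ i" "reciprocal f" "house f = lambda_rec i"
      "house f > 1"
    using lambda_rec_attained[OF assms] .
  let ?g = "f \<circ>\<^sub>p monom 1 2"
  have g: "degree ?g = 2 ^ Suc i" "reciprocal ?g" "skew_reciprocal ?g"
      "house ?g = sqrt (house f)" "house ?g > 1"
    using f assms by (simp_all add: degree_pcompose_square
        reciprocal_pcompose_square_iff skew_reciprocal_pcompose_square house_pcompose_square)
  have monic: "lead_coeff ?g = 1" using f(1) by (simp only: lead_coeff_pcompose_square)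
  have eq: "2 ^ Suc i * ln (house ?g) = r_seq i"
    using f g by (simp add: ln_sqrt r_seq_def)
  show "r_seq (Suc i) \<le> r_seq i" using r_seq_le[OF monic g(2,5), of "Suc i"] g(1) eq by simp
  have "lambda_skew (Suc i) \<le> house ?g" using lambda_skew_le[OF monic g(3,5,1)] .
  moreover have "lambda_skew (Suc i) > 1" using lambda_skew_gt_1 by simp
  ultimately have "ln (lambda_skew (Suc i)) \<le> ln (house ?g)" by simp
  then show "s_seq (Suc i) \<le> r_seq i" by (simp add: s_seq_def flip: eq)
qed

lemma r_seq_antimono:
  assumes "1 \<le> i" "i \<le> j"
  shows "r_seq j \<le> r_seq i"
  using assms(2)
proof (induction j rule: dec_induct)
  case (step j)
  then show ?case using seq_Suc_le_r_seq(1)[of j] assms(1) by simp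
qed simp

section \<open>Comparison of \<open>r_seq i\<close> with \<open>s_seq (Suc i)\<close>\<close>

text \<open>The zeroes of \<open>f\<close> are stable under \<open>\<alpha> -> -1/\<alpha>\<close>,
  those of \<open>p\<close> under \<open>\<alpha> -> 1/\<alpha>\<close>; together these give
  \<open>-\<alpha>\<close>. In terms of polynomials, the reflection of \<open>p(-t)\<close> divides
  \<open>f\<close> and equals \<open>p(-t)\<close> up to sign.\<close>

lemma pcompose_neg_dvd_skew_reciprocal:
  assumes f: "skew_reciprocal f" and p: "reciprocal p" "p dvd f"
  shows "p \<circ>\<^sub>p [:0, -1:] dvd f"
proof -
  let ?p = "p \<circ>\<^sub>p [:0, -1:]"
  obtain q where q: "f = p * q" using p(2) ..
  have "reflect_poly (f \<circ>\<^sub>p [:0, -1:]) = reflect_poly ?p * reflect_poly (q \<circ>\<^sub>p [:0, -1:])"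
    by (simp add: q pcompose_mult reflect_poly_mult)
  moreover have "f = smult ((-1) ^ (degree f div 2)) (reflect_poly (f \<circ>\<^sub>p [:0, -1:]))"
    using f by (simp add: skew_reciprocal_def)
  ultimately have "reflect_poly ?p dvd f" by (metis dvd_smult dvd_triv_left)
  moreover have "reflect_poly ?p = smult ((-1) ^ degree p) ?p"
  proof (rule poly_eqI)
    fix n
    have refl: "coeff p n = coeff (reflect_poly p) n" using p by (simp add: reciprocal_def)
    show "coeff (reflect_poly ?p) n = coeff (smult ((-1) ^ degree p) ?p) n"
    proof (cases "n \<le> degree p")
      case True
      then have "(-1::int) ^ (degree p - n) = (-1) ^ degree p * (-1) ^ n"
        by (cases "even (degree p)"; cases "even n") auto
      then show ?thesis using True refl
        by (simp add: coeff_pcompose_linear coeff_reflect_poly degree_pcompose)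
    next
      case False
      then show ?thesis by (simp add: coeff_pcompose_linear coeff_reflect_poly degree_pcompose coeff_eq_0)
    qed
  qed
  then have "?p dvd reflect_poly ?p" by (simp add: dvd_smult)
  ultimately show ?thesis using dvd_trans by blast
qed

text \<open>By smallness, the irreducible factor \<open>p\<close> carrying the house of an extremal
  skew-reciprocal \<open>f\<close> is reciprocal. It yields a competitor of degree at most
  \<open>2 ^ i\<close> for \<open>lambda_rec i\<close>: either \<open>p\<close> itself, or
  \<open>u\<close> with \<open>p = u(t^2)\<close>.\<close>

lemma r_seq_le_s_seq_Suc:
  assumes i: "i \<ge> 1" and small: "s_seq (Suc i) < ln (5 / 4) / 2"
  shows "r_seq i \<le> s_seq (Suc i)"
proof -
  obtain f where f: "lead_coeff f = 1" "degree f = 2 ^ Suc i" "skew_reciprocal f"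
      "house f = lambda_skew (Suc i)" "house f > 1"
    by (rule lambda_skew_attained[of "Suc i"]) simp
  have f0: "f \<noteq> 0" using f by auto
  obtain p where p: "irreducible p" "lead_coeff p = 1" "p dvd f" "0 < degree p"
      "degree p \<le> degree f" and hp: "house p = house f"
    using exists_irreducible_factor_same_house[of f] f by auto
  have p0: "p \<noteq> 0" using p(2) by auto
  have degp: "0 < degree p" "degree p \<le> 2 ^ Suc i" using p f by simp_all
  have s: "s_seq (Suc i) = 2 ^ Suc i * ln (house p)" using f hp by (simp add: s_seq_def)
  have lnp: "ln (house p) > 0" using hp f by simp
  have "degree p * ln (house p) \<le> s_seq (Suc i)"
    unfolding s using of_nat_mono[OF degp(2), where 'a = real] lnp by (intro mult_right_mono) auto
  then have recp: "reciprocal p"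
    using reciprocal_or_house_large[OF p(1,2)] hp f small by auto
  let ?p = "p \<circ>\<^sub>p [:0, -1:]"
  have p': "?p dvd f" using pcompose_neg_dvd_skew_reciprocal f recp p by blast
  have degp': "degree ?p = degree p" by (simp add: degree_pcompose)
  have p'0: "?p \<noteq> 0" using degp degp' by auto
  show ?thesis
  proof (cases "p dvd ?p")
    case True
    \<comment> \<open>Equal degrees make \<open>p(-t)\<close> a constant multiple of
      \<open>p\<close>; the constant coefficient 1 forces the constant to be 1, so \<open>p\<close>
      is even.\<close>
    then obtain h where h: "?p = p * h" ..
    then have "h \<noteq> 0" using p'0 by auto
    then have "degree h = 0" using h p0 degp' by (simp add: degree_mult_eq)
    then obtain c where c: "h = [:c:]" by (rule degree_eq_zeroE)
    have coeff: "(-1) ^ n * coeff p n = c * coeff p n" for n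
      using arg_cong[OF h, of "\<lambda>q. coeff q n"] by (simp add: c coeff_pcompose_linear)
    have "coeff p 0 = 1" using recp p(2) by (metis coeff_0_reflect_poly reciprocal_def)
    then have "c = 1" using coeff[of 0] by simp
    then have "coeff p n = 0" if "odd n" for n using coeff[of n] that by simp
    then obtain u where u: "p = u \<circ>\<^sub>p monom 1 2" by (rule even_poly_eq_pcompose_square)
    then have "degree p = 2 * degree u" by (simp add: degree_pcompose_square)
    then have degu: "0 < degree u" "degree u \<le> 2 ^ i" using degp by auto
    have "house p = sqrt (house u)" using u house_pcompose_square[OF degu(1)] by simp
    moreover from this have "house u > 1" using hp f by simp
    ultimately have "r_seq i \<le> 2 ^ i * (2 * ln (house p))"
      using r_seq_le[of u i] degu i u p(2) recp
      by (simp add: lead_coeff_pcompose_square reciprocal_pcompose_square_iff ln_sqrt)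
    then show ?thesis by (simp add: s)
  next
    case False
    obtain q where q: "f = ?p * q" using p' ..
    \<comment> \<open>The prime \<open>p\<close> divides \<open>p(-t) q\<close> but not
      \<open>p(-t)\<close>. Hence \<open>p(t) p(-t)\<close> divides \<open>f\<close>, and
      \<open>p\<close> has at most half the degree of \<open>f\<close>.\<close>
    have "p dvd q"
      using irreducible_imp_prime_elem[OF p(1)] p(3) False q by (metis prime_elem_dvd_multD)
    then obtain h where "f = ?p * (p * h)" using q by blast
    then have "?p * p dvd f" by (simp add: mult.assoc)
    then have "degree (?p * p) \<le> 2 ^ Suc i" using dvd_imp_degree_le f0 f(2) by metis
    then have "degree p \<le> 2 ^ i" using p0 p'0 degp' by (simp add: degree_mult_eq)
    then have "r_seq i \<le> 2 ^ i * ln (house p)"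
      using r_seq_le[of p i] p recp hp f degp i by simp
    also have "\<dots> \<le> s_seq (Suc i)" using lnp by (simp add: s)
    finally show ?thesis .
  qed
qed

section \<open>Telescoping of the quotients\<close>

lemma q_seq_quotient_Suc:
  "q_seq (Suc N) / q_seq n = q_seq N / q_seq n * (r_seq (Suc N) / s_seq (Suc N))"
  by (simp add: q_seq_def)

lemma q_seq_nonzero: "q_seq n \<noteq> 0"
  using r_seq_pos s_seq_pos by (fastforce simp: q_seq_def)

text \<open>The quotient regroups as \<open>r_N / s_{n+1}\<close> times the product of
  \<open>r_i / s_{i+1}\<close> over \<open>n < i < N\<close>, and each of these inner factors is at
  least 1.\<close>

lemma q_seq_quotient_ge:
  assumes "1 \<le> n" "n < N"
  shows "r_seq N / s_seq (Suc n) \<le> q_seq N / q_seq n"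
  using Suc_leI[OF assms(2)]
proof (induction N rule: dec_induct)
  case base
  then show ?case using q_seq_quotient_Suc[of n n] q_seq_nonzero by simp
next
  case (step N)
  have pos: "r_seq N > 0" "r_seq (Suc N) > 0" "s_seq (Suc N) > 0" "s_seq (Suc n) > 0"
    using r_seq_pos s_seq_pos assms step by auto
  have "r_seq (Suc N) / s_seq (Suc n) * 1 \<le> r_seq (Suc N) / s_seq (Suc n) * (r_seq N / s_seq (Suc N))"
    using pos seq_Suc_le_r_seq(2)[of N] assms step by (intro mult_left_mono) auto
  also have "\<dots> = r_seq N / s_seq (Suc n) * (r_seq (Suc N) / s_seq (Suc N))" by simp
  also have "\<dots> \<le> q_seq N / q_seq n * (r_seq (Suc N) / s_seq (Suc N))"
    using step pos by (intro mult_right_mono) auto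
  also have "\<dots> = q_seq (Suc N) / q_seq n" using q_seq_quotient_Suc[of N n] assms step by simp
  finally show ?case by simp
qed

text \<open>The same regrouping, with every inner factor equal to 1.\<close>

lemma q_seq_quotient_eq:
  assumes "1 \<le> n" "n < N" "\<And>i. i > n \<Longrightarrow> r_seq i = s_seq (Suc i)"
  shows "q_seq N / q_seq n = r_seq N / s_seq (Suc n)"
  using Suc_leI[OF assms(2)]
proof (induction N rule: dec_induct)
  case base
  then show ?case using q_seq_quotient_Suc[of n n] q_seq_nonzero by simp
next
  case (step N)
  then have "s_seq (Suc N) > 0" "r_seq N = s_seq (Suc N)" using s_seq_pos assms(3) by auto
  then show ?case using q_seq_quotient_Suc[of N n] assms step by simp
qed

section \<open>Lower bounds for \<open>r_seq\<close> and for all houses\<close>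

text \<open>An extremal polynomial has an irreducible factor with the same house and degree at most
  \<open>2 ^ i\<close>, to which the hypothesis applies.\<close>

lemma r_seq_bounded_below_of_house_bound:
  assumes "c > 0"
    and bound: "\<And>f::int poly. irreducible f \<Longrightarrow> lead_coeff f = 1 \<Longrightarrow> house f > 1 \<Longrightarrow>
      house f \<ge> 1 + c / real (degree f)"
    and i: "i \<ge> 1"
  shows "c / (1 + c) \<le> r_seq i"
proof -
  obtain f where f: "lead_coeff f = 1" "degree f = 2 ^ i" "reciprocal f" "house f = lambda_rec i"
      "house f > 1"
    using lambda_rec_attained[OF i] .
  obtain p where p: "irreducible p" "lead_coeff p = 1" "0 < degree p" "degree p \<le> degree f"
      "house p = house f"
    using exists_irreducible_factor_same_house[of f] f by auto
  have "degree p \<le> 2 ^ i" using p f by simp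
  then have "real (degree p) \<le> 2 ^ i" by (metis of_nat_le_iff of_nat_numeral of_nat_power)
  then have "c / 2 ^ i \<le> c / degree p" using p(3) \<open>c > 0\<close> by (intro divide_left_mono) auto
  then have le: "1 + c / 2 ^ i \<le> lambda_rec i" using bound[OF p(1,2)] p(5) f by simp
  define x where "x = c / 2 ^ i"
  have x: "x > 0" "x \<le> c" using \<open>c > 0\<close> by (auto simp: x_def divide_simps)
  \<comment> \<open>Here \<open>2 ^ i * ln (1 + x) \<ge> 2 ^ i * x / (1 + x) = c / (1 + x)\<close>,
    and \<open>x \<le> c\<close> makes the bound independent of \<open>i\<close>.\<close>
  have "c / (1 + c) \<le> c / (1 + x)" using x \<open>c > 0\<close> by (intro divide_left_mono) auto
  also have "\<dots> = 2 ^ i * (1 - 1 / (1 + x))"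
  proof -
    have "c = 2 ^ i * x" by (simp add: x_def)
    moreover have "1 - 1 / (1 + x) = x / (1 + x)" using x by (simp add: field_simps)
    ultimately show ?thesis by simp
  qed
  also have "1 - 1 / (1 + x) \<le> ln (1 + x)"
    using ln_le_minus_one[of "1 / (1 + x)"] x by (simp add: ln_div)
  also have "ln (1 + x) \<le> ln (lambda_rec i)" using le x by (simp add: x_def)
  finally show ?thesis by (simp add: r_seq_def)
qed

text \<open>Padding a reciprocal \<open>f\<close> to a power of two at most doubles its degree,
  whence \<open>\<kappa> / 2\<close>; the bound \<open>\<kappa> \<le> ln (5 / 4)\<close> covers the
  non-reciprocal case.\<close>

lemma house_bound_of_r_seq_bounded_below:
  fixes f :: "int poly"
  assumes \<kappa>: "\<kappa> > 0" "\<kappa> \<le> ln (5 / 4)" "\<And>i. i \<ge> 1 \<Longrightarrow> \<kappa> \<le> r_seq i"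
    and f: "irreducible f" "lead_coeff f = 1" "house f > 1"
  shows "1 + (\<kappa> / 2) / real (degree f) \<le> house f"
proof (cases "degree f = 0")
  \<comment> \<open>Division by zero yields zero, so the claim reads
    \<open>1 \<le> house f\<close>.\<close>
  case True
  then show ?thesis using f by simp
next
  case False
  let ?d = "degree f"
  have "\<kappa> / 2 \<le> ?d * ln (house f)"
    using reciprocal_or_house_large[OF f]
  proof
    assume rec: "reciprocal f"
    obtain j where j: "?d \<le> 2 ^ j" and min: "\<And>k. k < j \<Longrightarrow> 2 ^ k < ?d"
      using exists_least_iff[of "\<lambda>j. ?d \<le> 2 ^ j"] less_exp[of ?d] by (meson less_imp_le not_le)
    \<comment> \<open>The index must be at least 1. For \<open>j = 0\<close> the degree is 1, and
      \<open>2 ^ i = 2\<close> is still at most twice the degree.\<close>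
    define i where "i = max 1 j"
    have "i \<ge> 1" and upper: "?d \<le> 2 ^ i"
      using order_trans[OF j power_increasing[of j i]] by (simp_all add: i_def)
    moreover have "2 ^ i \<le> 2 * ?d"
    proof (cases j)
      case 0
      then show ?thesis using False by (simp add: i_def)
    next
      case (Suc k)
      then show ?thesis using min[of k] by (simp add: i_def max_def)
    qed
    then have "real (2 ^ i) \<le> real (2 * ?d)" by (rule of_nat_mono)
    then have "2 ^ i * ln (house f) \<le> (2 * ?d) * ln (house f)"
      using f by (intro mult_right_mono) auto
    moreover have "r_seq i \<le> 2 ^ i * ln (house f)"
      using r_seq_le[OF f(2) rec f(3)] False upper \<open>i \<ge> 1\<close> by simp
    ultimately show ?thesis using \<kappa>(3)[of i] by simp
  next
    assume "ln (5 / 4) / 2 \<le> ?d * ln (house f)"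
    then show ?thesis using \<kappa> by simp
  qed
  then have "(\<kappa> / 2) / ?d \<le> ln (house f)" using False by (simp add: field_simps)
  moreover have "ln (house f) \<le> house f - 1" using f by (intro ln_le_minus_one) simp
  ultimately show ?thesis by simp
qed

theorem theorem2:
  shows "(\<exists>c::real. c > 0 \<and>
            (\<forall>f::int poly. irreducible f \<longrightarrow> lead_coeff f = 1 \<longrightarrow> house f > 1 \<longrightarrow>
               house f \<ge> 1 + c / real (degree f)))
     \<longleftrightarrow> bounded_away_from_zero {q_seq N / q_seq n | n N. 1 \<le> n \<and> n < N}"
    (is "?A \<longleftrightarrow> ?B")
proof
  assume ?A
  then obtain c where "c > 0" and c: "\<And>i. i \<ge> 1 \<Longrightarrow> c / (1 + c) \<le> r_seq i"
    using r_seq_bounded_below_of_house_bound by metis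
  \<comment> \<open>The numerator bounds \<open>r_N\<close> from below; the denominator comes from
    \<open>s_{n+1} \<le> r_n \<le> r_1\<close>.\<close>
  define \<epsilon> where "\<epsilon> = (c / (1 + c)) / r_seq 1"
  have "\<epsilon> > 0" using \<open>c > 0\<close> r_seq_pos[of 1] by (simp add: \<epsilon>_def)
  moreover have "\<epsilon> \<le> \<bar>q_seq N / q_seq n\<bar>" if "1 \<le> n" "n < N" for n N
  proof -
    have "s_seq (Suc n) \<le> r_seq 1" "s_seq (Suc n) > 0" "r_seq 1 > 0"
      using seq_Suc_le_r_seq(2)[of n] r_seq_antimono[of 1 n] s_seq_pos r_seq_pos that by auto
    then have "\<epsilon> \<le> r_seq N / s_seq (Suc n)"
      unfolding \<epsilon>_def using c[of N] that r_seq_pos[of N] by (intro frac_le) auto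
    also have "\<dots> \<le> q_seq N / q_seq n" using that by (rule q_seq_quotient_ge)
    finally show ?thesis by (simp only: order_trans[OF _ abs_ge_self])
  qed
  ultimately show ?B unfolding bounded_away_from_zero_def by blast
next
  assume ?B
  then obtain \<epsilon> where "\<epsilon> > 0" and \<epsilon>: "\<And>n N. 1 \<le> n \<Longrightarrow> n < N \<Longrightarrow> \<epsilon> \<le> \<bar>q_seq N / q_seq n\<bar>"
    unfolding bounded_away_from_zero_def by blast
  have "\<exists>\<kappa>>0. \<forall>i\<ge>1. \<kappa> \<le> r_seq i"
  proof (rule ccontr)
    assume "\<not> ?thesis"
    then have small: "\<exists>i\<ge>1. r_seq i < \<delta>" if "\<delta> > 0" for \<delta>
      using that by (meson not_le)
    \<comment> \<open>Beyond this index \<open>s_{i+1} \<le> r_i \<le> r_n\<close> is below the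
      threshold of \<open>r_seq_le_s_seq_Suc\<close>, which forces
      \<open>r_i = s_{i+1}\<close>.\<close>
    obtain n where n: "n \<ge> 1" "r_seq n < ln (5 / 4) / 2" using small[of "ln (5 / 4) / 2"] by auto
    have eq: "r_seq i = s_seq (Suc i)" if "i > n" for i
    proof (rule antisym)
      have "s_seq (Suc i) < ln (5 / 4) / 2"
        using seq_Suc_le_r_seq(2)[of i] r_seq_antimono[of n i] n that by auto
      then show "r_seq i \<le> s_seq (Suc i)" using r_seq_le_s_seq_Suc n that by simp
      show "s_seq (Suc i) \<le> r_seq i" using seq_Suc_le_r_seq(2) n that by simp
    qed
    have s: "s_seq (Suc n) > 0" by (simp add: s_seq_pos)
    \<comment> \<open>With \<open>n\<close> fixed the quotient is \<open>r_N / s_{n+1}\<close>. The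
      choice of \<open>m\<close> pushes it below \<open>\<epsilon>\<close>, and monotonicity carries
      this to some \<open>N\<close> past \<open>n\<close>.\<close>
    obtain m where m: "m \<ge> 1" "r_seq m < \<epsilon> * s_seq (Suc n)" using small[of "\<epsilon> * s_seq (Suc n)"] \<open>\<epsilon> > 0\<close> s by auto
    define N where "N = max m (Suc n)"
    have N: "N > n" "r_seq N < \<epsilon> * s_seq (Suc n)" "r_seq N > 0"
      using r_seq_antimono[of m N] m r_seq_pos[of N] by (auto simp: N_def)
    have "\<epsilon> \<le> \<bar>r_seq N / s_seq (Suc n)\<bar>"
      using \<epsilon>[OF n(1) N(1)] q_seq_quotient_eq[OF n(1) N(1) eq] by simp
    then show False using N s by (simp add: pos_le_divide_eq)
  qed
  then obtain \<kappa> where "\<kappa> > 0" "\<And>i. i \<ge> 1 \<Longrightarrow> \<kappa> \<le> r_seq i" by blast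
  \<comment> \<open>Taking the minimum secures the requirement that the constant be at most
    \<open>ln (5 / 4)\<close>.\<close>
  then have "1 + (min \<kappa> (ln (5 / 4)) / 2) / real (degree f) \<le> house f"
    if "irreducible f" "lead_coeff f = 1" "house f > 1" for f :: "int poly"
    using that by (intro house_bound_of_r_seq_bounded_below) (auto intro: min.coboundedI1)
  moreover have "min \<kappa> (ln (5 / 4)) / 2 > 0" using \<open>\<kappa> > 0\<close> by simp
  ultimately show ?A by blast
qed

end
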